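(* Let $p_i$ denote the $i$-th prime, let $j$ be a positive integer, and let $f:\mathbb{N}\to\mathbb{N}$ be a function with $f(1)=1$ such that (i) for every $i$ and every prime $p_r$ dividing $f(i)$ we have $r<i$, and (ii) for every $t\in\mathbb{N}$ the equation $f(s)=t$ has only finitely many solutions $s$. Let $H$ be the completely additive function determined by $H(p_i)=H(f(i))+j$ for all $i\ge1$ (well defined by recursion on $i$ thanks to (i)). Then $H$ is a height function.
   Context: $\mathbb{N}$ denotes the positive integers. A function $H:\mathbb{N}\to\mathbb{N}\cup\{0\}$ is completely additive if $H(ab)=H(a)+H(b)$ for all positive integers $a,b$ (so $H(1)=0$). A height function is a completely additive $H:\mathbb{N}\to\mathbb{N}\cup\{0\}$ such that (a) for every integer $n>0$ only finitely many primes $p$ satisfy $H(p)=n$, and (b) $H(p)\neq0$ for every prime $p$. *)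

theory Defs
  imports "HOL-Computational_Algebra.Primes" "HOL-Library.Infinite_Set"
begin

text \<open>
  The positive integers are represented by type \<^typ>\<open>nat\<close> with explicit positivity guards;
  the values of functions at \<open>0\<close> are unconstrained.
\<close>

text \<open>Indexed from \<open>1\<close>, so \<open>ith_prime 1 = 2\<close>; \<open>ith_prime 0\<close> is a junk value.\<close>

definition ith_prime :: "nat \<Rightarrow> nat" where
  "ith_prime i = enumerate {p. prime p} (i - 1)"

definition completely_additive :: "(nat \<Rightarrow> nat) \<Rightarrow> bool" where
  "completely_additive H \<longleftrightarrow> (\<forall>a>0. \<forall>b>0. H (a * b) = H a + H b)"

definition height_function :: "(nat \<Rightarrow> nat) \<Rightarrow> bool" where
  "height_function H \<longleftrightarrow>
     completely_additive H \<and>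
     (\<forall>n>0. finite {p. prime p \<and> H p = n}) \<and>
     (\<forall>p. prime p \<longrightarrow> H p \<noteq> 0)"

definition recursive_additive :: "(nat \<Rightarrow> nat) \<Rightarrow> nat \<Rightarrow> (nat \<Rightarrow> nat) \<Rightarrow> bool" where
  "recursive_additive f j H \<longleftrightarrow>
     completely_additive H \<and> (\<forall>i\<ge>1. H (ith_prime i) = H (f i) + j)"

end

theory Submission
  imports Defs
begin

text \<open>
  Everything rests on the finiteness of the sets of positive integers of bounded height. If only
  finitely many \<open>k\<close> have \<open>H k < m\<close>, then, since \<open>H (p\<^sub>i) \<le> m\<close> forces \<open>H (f i) < m\<close> and \<open>f\<close> has
  finite fibres, only finitely many primes have height at most \<open>m\<close>. An integer \<open>n > 1\<close> of height
  at most \<open>m\<close> is a product \<open>p k\<close> of such a prime and an integer \<open>k\<close> with \<open>H k < m\<close>, so there are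
  finitely many of these as well.
\<close>

text \<open>This needs no guard on the index: truncated subtraction makes \<open>ith_prime 0\<close>
  equal to \<open>ith_prime 1\<close>, that is 2.\<close>

lemma prime_ith_prime: "prime (ith_prime i)"
  using enumerate_in_set[OF primes_infinite, of "i - 1"] by (simp add: ith_prime_def)

lemma ex_ith_prime:
  assumes "prime p"
  obtains i where "i \<ge> 1" and "p = ith_prime i"
proof -
  obtain k where "enumerate {p. prime p} k = p"
    using enumerate_Ex[of "{p. prime p}" p] assms primes_infinite by auto
  then show thesis
    using that[of "Suc k"] by (simp add: ith_prime_def)
qed

lemma ith_prime_less_iff:
  assumes "i \<ge> 1" and "r \<ge> 1"
  shows "ith_prime i < ith_prime r \<longleftrightarrow> i < r"
  using assms enumerate_mono_iff[OF primes_infinite, of "i - 1" "r - 1"]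
  by (auto simp: ith_prime_def)

lemma ith_prime_eq_iff:
  assumes "i \<ge> 1" and "r \<ge> 1"
  shows "ith_prime i = ith_prime r \<longleftrightarrow> i = r"
  using ith_prime_less_iff[OF assms] ith_prime_less_iff[OF assms(2,1)]
  by (metis less_irrefl linorder_neqE_nat)

lemma le_ith_prime: "i \<le> ith_prime i"
proof (induction i)
  case (Suc i)
  show ?case
  \<comment> \<open>Indices 0 and 1 give the same prime, so the strict increase is available only
    from index 1 on.\<close>
  proof (cases "i = 0")
    case True
    then show ?thesis
      using prime_gt_0_nat[OF prime_ith_prime, of 1] by simp
  next
    case False
    then have "ith_prime i < ith_prime (Suc i)"
      by (simp add: ith_prime_less_iff)
    with Suc.IH show ?thesis by simp
  qed
qed simp

lemma index_le_if_ith_prime_dvd: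
  assumes "ith_prime r dvd n" and "n > 0"
  shows "r \<le> n"
  using le_ith_prime[of r] dvd_imp_le[OF assms] by (rule order_trans)

lemma completely_additive_mult:
  "completely_additive H \<Longrightarrow> a > 0 \<Longrightarrow> b > 0 \<Longrightarrow> H (a * b) = H a + H b"
  by (simp add: completely_additive_def)

lemma completely_additive_one: "completely_additive H \<Longrightarrow> H 1 = 0"
  using completely_additive_mult[of H 1 1] by simp

lemma prime_factor_decomposition:
  fixes n :: nat
  assumes "n > 1"
  obtains p k where "prime p" and "n = p * k" and "k > 0" and "k < n"
proof -
  obtain p where p: "prime p" "p dvd n"
    using prime_factor_nat[of n] assms by auto
  then obtain k where k: "n = p * k" by (auto elim: dvdE)
  moreover have "k > 0" using k assms by (cases k) auto
  moreover have "k < n" using k \<open>k > 0\<close> prime_gt_1_nat[OF p(1)] by simp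
  ultimately show thesis using that p(1) by blast
qed

text \<open>Split off one prime factor at a time. Agreement is asked only at primes dividing
  \<open>n\<close>, because the uniqueness proof knows no more than that at its inductive
  step.\<close>

lemma completely_additive_eqI:
  assumes H: "completely_additive H" and H': "completely_additive H'" and "n > 0"
    and "\<And>p. prime p \<Longrightarrow> p dvd n \<Longrightarrow> H p = H' p"
  shows "H n = H' n"
  using assms(3,4)
proof (induction n rule: less_induct)
  case (less n)
  show ?case
  proof (cases "n = 1")
    case True
    then show ?thesis
      using completely_additive_one[OF H] completely_additive_one[OF H'] by simp
  next
    case False
    with less.prems(1) have "n > 1" by simp
    then obtain p k where pk: "prime p" "n = p * k" "k > 0" "k < n"
      by (rule prime_factor_decomposition)
    have "H p = H' p" using less.prems(2)[OF pk(1)] pk(2) by simp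
    moreover have "H k = H' k"
      using less.IH[OF pk(4,3)] less.prems(2) pk(2) by simp
    ultimately show ?thesis
      using pk prime_gt_0_nat[OF pk(1)]
      by (simp add: completely_additive_mult[OF H] completely_additive_mult[OF H'])
  qed
qed

text \<open>For \<open>n > 0\<close> the cut-off at \<open>n\<close> loses nothing: the
  \<open>r\<close>-th prime is at least \<open>r\<close>, so primes of index above \<open>n\<close>
  cannot divide \<open>n\<close>.\<close>

definition additive_extension :: "(nat \<Rightarrow> nat) \<Rightarrow> nat \<Rightarrow> nat" where
  "additive_extension g n = (\<Sum>r = 1..n. multiplicity (ith_prime r) n * g r)"

text \<open>Indices of primes not dividing \<open>n\<close> contribute 0, so the index set can be
  chosen to suit each use.\<close>

lemma additive_extension_eq_sum:
  assumes "finite R" and "R \<subseteq> {1..}" and "n > 0"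
    and R: "\<And>r. r \<ge> 1 \<Longrightarrow> ith_prime r dvd n \<Longrightarrow> r \<in> R"
  shows "additive_extension g n = (\<Sum>r\<in>R. multiplicity (ith_prime r) n * g r)"
proof -
  let ?t = "\<lambda>r. multiplicity (ith_prime r) n * g r"
  have zero: "?t r = 0" if "\<not> ith_prime r dvd n" for r
    using that by (simp add: not_dvd_imp_multiplicity_0)
  have "(\<Sum>r\<in>{1..n}. ?t r) = (\<Sum>r\<in>{1..n} \<union> R. ?t r)"
  proof (rule sum.mono_neutral_left)
    show "\<forall>r\<in>{1..n} \<union> R - {1..n}. ?t r = 0"
      using assms(2) index_le_if_ith_prime_dvd[OF _ \<open>n > 0\<close>] by (intro ballI zero) auto
  qed (use assms(1) in auto)
  also have "\<dots> = (\<Sum>r\<in>R. ?t r)"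
  proof (rule sum.mono_neutral_right)
    show "\<forall>r\<in>{1..n} \<union> R - R. ?t r = 0"
      using R by (intro ballI zero) auto
  qed (use assms(1) in auto)
  finally show ?thesis by (simp add: additive_extension_def)
qed

lemma completely_additive_additive_extension: "completely_additive (additive_extension g)"
  unfolding completely_additive_def
proof (intro allI impI)
  fix a b :: nat
  assume pos: "a > 0" "b > 0"
  \<comment> \<open>One index range serves \<open>a\<close>, \<open>b\<close> and
    \<open>a * b\<close> alike, so additivity can be checked term by term.\<close>
  have ext: "additive_extension g c = (\<Sum>r = 1..a * b. multiplicity (ith_prime r) c * g r)"
    if "c dvd a * b" for c
  proof (rule additive_extension_eq_sum)
    show "c > 0" using that pos by (auto intro: Nat.gr0I)
    show "r \<in> {1..a * b}" if "r \<ge> 1" "ith_prime r dvd c" for r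
      using that index_le_if_ith_prime_dvd[of r "a * b"] \<open>c dvd a * b\<close> pos dvd_trans by auto
  qed auto
  have "multiplicity (ith_prime r) (a * b) = multiplicity (ith_prime r) a + multiplicity (ith_prime r) b"
    for r
    using pos prime_ith_prime[of r] by (intro prime_elem_multiplicity_mult_distrib) auto
  then show "additive_extension g (a * b) = additive_extension g a + additive_extension g b"
    by (simp add: ext sum.distrib add_mult_distrib)
qed

lemma additive_extension_ith_prime:
  assumes "i \<ge> 1"
  shows "additive_extension g (ith_prime i) = g i"
proof -
  have "additive_extension g (ith_prime i)
      = (\<Sum>r\<in>{i}. multiplicity (ith_prime r) (ith_prime i) * g r)"
  proof (rule additive_extension_eq_sum)
    fix r assume "r \<ge> 1" and "ith_prime r dvd ith_prime i"
    then show "r \<in> {i}"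
      using primes_dvd_imp_eq[OF prime_ith_prime prime_ith_prime, of r i] assms
      by (simp add: ith_prime_eq_iff)
  qed (use assms prime_gt_0_nat[OF prime_ith_prime] in auto)
  also have "\<dots> = g i"
    using prime_ith_prime[of i] by simp
  finally show ?thesis .
qed

text \<open>
  \<open>prime_height f j i\<close> is the value of the height function at the \<open>i\<close>-th prime. Condition (i) on
  \<open>f\<close> says that the sum, truncated at \<open>i\<close>, runs over all prime factors of \<open>f i\<close>.
\<close>
fun prime_height :: "(nat \<Rightarrow> nat) \<Rightarrow> nat \<Rightarrow> nat \<Rightarrow> nat" where
  "prime_height f j i =
     (\<Sum>r\<in>{1..<i}. multiplicity (ith_prime r) (f i) * prime_height f j r) + j"

declare prime_height.simps [simp del]

text \<open>The recursion of \<open>prime_height\<close> is the required equation with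
  \<open>H (f i)\<close> expanded over the prime factors of \<open>f i\<close>.\<close>

lemma recursive_additive_exists:
  assumes "\<And>i. i \<ge> 1 \<Longrightarrow> f i \<ge> 1"
    and "\<And>i r. i \<ge> 1 \<Longrightarrow> r \<ge> 1 \<Longrightarrow> ith_prime r dvd f i \<Longrightarrow> r < i"
  shows "recursive_additive f j (additive_extension (prime_height f j))"
  unfolding recursive_additive_def
proof (intro conjI allI impI)
  fix i :: nat
  assume i: "i \<ge> 1"
  have "additive_extension (prime_height f j) (f i)
      = (\<Sum>r\<in>{1..<i}. multiplicity (ith_prime r) (f i) * prime_height f j r)"
    using assms(1)[OF i] assms(2)[OF i] by (intro additive_extension_eq_sum) auto
  then show "additive_extension (prime_height f j) (ith_prime i)
      = additive_extension (prime_height f j) (f i) + j"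
    by (simp add: additive_extension_ith_prime[OF i] prime_height.simps[of f j i])
qed (rule completely_additive_additive_extension)

text \<open>Strong induction on the index of a prime: the value at the \<open>i\<close>-th prime is
  fixed by that at \<open>f i\<close>, whose prime factors all have smaller index.\<close>

lemma recursive_additive_unique:
  assumes "\<And>i. i \<ge> 1 \<Longrightarrow> f i \<ge> 1"
    and f_primes: "\<And>i r. i \<ge> 1 \<Longrightarrow> r \<ge> 1 \<Longrightarrow> ith_prime r dvd f i \<Longrightarrow> r < i"
    and "recursive_additive f j H" and "recursive_additive f j H'" and "n \<ge> 1"
  shows "H n = H' n"
proof -
  have H: "completely_additive H" "\<And>i. i \<ge> 1 \<Longrightarrow> H (ith_prime i) = H (f i) + j"
    and H': "completely_additive H'" "\<And>i. i \<ge> 1 \<Longrightarrow> H' (ith_prime i) = H' (f i) + j"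
    using assms(3,4) by (auto simp: recursive_additive_def)
  have primes: "H (ith_prime i) = H' (ith_prime i)" if "i \<ge> 1" for i
    using that
  proof (induction i rule: less_induct)
    case (less i)
    have "H (f i) = H' (f i)"
    proof (rule completely_additive_eqI[OF H(1) H'(1)])
      fix p assume "prime p" and dvd: "p dvd f i"
      then obtain r where r: "r \<ge> 1" "p = ith_prime r" by (auto elim: ex_ith_prime)
      then have "r < i" using f_primes[OF less.prems] dvd by simp
      then show "H p = H' p" using less.IH r by simp
    qed (use assms(1)[OF less.prems] in simp)
    then show ?case using H(2) H'(2) less.prems by simp
  qed
  show ?thesis
  proof (rule completely_additive_eqI[OF H(1) H'(1)])
    fix p :: nat assume "prime p"
    then show "H p = H' p" using primes by (auto elim: ex_ith_prime)
  qed (use \<open>n \<ge> 1\<close> in simp)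
qed

text \<open>The strict bound makes the base case the empty set.\<close>

lemma finite_height_less:
  assumes "j > 0"
    and f_pos: "\<And>i. i \<ge> 1 \<Longrightarrow> f i \<ge> 1"
    and f_fibres: "\<And>t. t \<ge> 1 \<Longrightarrow> finite {s. s \<ge> 1 \<and> f s = t}"
    and "recursive_additive f j H"
  shows "finite {n. n \<ge> 1 \<and> H n < m}"
proof (induction m)
  case (Suc m)
  have H: "completely_additive H" "\<And>i. i \<ge> 1 \<Longrightarrow> H (ith_prime i) = H (f i) + j"
    using assms(4) by (auto simp: recursive_additive_def)
  define A where "A = {n. n \<ge> 1 \<and> H n < m}"
  \<comment> \<open>These are the primes whose index is sent by \<open>f\<close> into
    \<open>A\<close>; all primes of height at most \<open>m\<close> are among them.\<close>
  define P where "P = ith_prime ` (\<Union>t\<in>A. {s. s \<ge> 1 \<and> f s = t})"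
  have "finite A" using Suc.IH by (simp add: A_def)
  have "finite P"
    unfolding P_def using \<open>finite A\<close> f_fibres by (auto simp: A_def)
  have "{n. n \<ge> 1 \<and> H n < Suc m} \<subseteq> insert 1 ((\<lambda>(p, k). p * k) ` (P \<times> A))"
  proof
    fix n assume "n \<in> {n. n \<ge> 1 \<and> H n < Suc m}"
    then have n: "n \<ge> 1" "H n \<le> m" by auto
    show "n \<in> insert 1 ((\<lambda>(p, k). p * k) ` (P \<times> A))"
    proof (cases "n = 1")
      case False
      with n(1) have "n > 1" by simp
      then obtain p k where pk: "prime p" "n = p * k" "k > 0"
        by (rule prime_factor_decomposition)
      obtain i where i: "i \<ge> 1" "p = ith_prime i" using pk(1) by (rule ex_ith_prime)
      have "H n = H (f i) + j + H k"
        using pk i H prime_gt_0_nat[OF pk(1)] by (simp add: completely_additive_mult)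
      \<comment> \<open>The summand \<open>j\<close> pushes both other terms strictly below
        \<open>m\<close>, where the induction hypothesis applies.\<close>
      with n(2) \<open>j > 0\<close> have "H (f i) < m" and "H k < m" by auto
      then have "p \<in> P" and "k \<in> A"
        using i f_pos[OF i(1)] pk(3) by (auto simp: P_def A_def)
      with pk(2) show ?thesis by auto
    qed simp
  qed
  moreover have "finite (insert 1 ((\<lambda>(p, k). p * k) ` (P \<times> A)))"
    using \<open>finite A\<close> \<open>finite P\<close> by simp
  ultimately show ?case by (rule finite_subset)
qed simp

text \<open>Primes of height \<open>n\<close> lie in the finite set of integers of height below
  \<open>n + 1\<close>, and every prime has height at least \<open>j > 0\<close>.\<close>

lemma recursive_additive_height_function:
  assumes "j > 0"
    and "\<And>i. i \<ge> 1 \<Longrightarrow> f i \<ge> 1"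
    and "\<And>t. t \<ge> 1 \<Longrightarrow> finite {s. s \<ge> 1 \<and> f s = t}"
    and H: "recursive_additive f j H"
  shows "height_function H"
  unfolding height_function_def
proof (intro conjI allI impI)
  show "completely_additive H" using H by (simp add: recursive_additive_def)
  show "finite {p. prime p \<and> H p = n}" for n
    by (rule finite_subset[OF _ finite_height_less[OF assms, of "Suc n"]])
       (auto dest: prime_ge_1_nat)
  fix p :: nat assume "prime p"
  then obtain i where "i \<ge> 1" "p = ith_prime i" by (rule ex_ith_prime)
  then show "H p \<noteq> 0" using H \<open>j > 0\<close> by (simp add: recursive_additive_def)
qed

theorem theorem3p1:
  fixes f :: "nat \<Rightarrow> nat" and j :: nat
  assumes j_pos: "j > 0"
    and f_pos: "\<And>i. i \<ge> 1 \<Longrightarrow> f i \<ge> 1"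
    and f_1: "f 1 = 1"
    and f_primes: "\<And>i r. i \<ge> 1 \<Longrightarrow> r \<ge> 1 \<Longrightarrow> ith_prime r dvd f i \<Longrightarrow> r < i"
    and f_fibres: "\<And>t. t \<ge> 1 \<Longrightarrow> finite {s. s \<ge> 1 \<and> f s = t}"
  shows "(\<exists>H. recursive_additive f j H) \<and>
         (\<forall>H H'. recursive_additive f j H \<longrightarrow> recursive_additive f j H' \<longrightarrow>
            (\<forall>n\<ge>1. H n = H' n)) \<and>
         (\<forall>H. recursive_additive f j H \<longrightarrow> height_function H)"
  using recursive_additive_exists[of f j, OF f_pos f_primes]
    recursive_additive_unique[of f j, OF f_pos f_primes]
    recursive_additive_height_function[of j f, OF j_pos f_pos f_fibres]
  by blast

end
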